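(* Let $G(s)=C(sI-A)^{-1}B$ be a stable system, with real matrices $A\in\mathbb R^{n\times n}$, $B\in\mathbb R^{n\times m_w}$, $C\in\mathbb R^{p_z\times n}$. Then $$\mathcal K(G):=\sup_{\mathrm{Re}(s)>0}\mathrm{Re}(s)\,\overline{\sigma}\left(C(sI-A)^{-1}B\right)\;\leq\;\sup_{t\geq 0}\overline{\sigma}\left(Ce^{At}B\right)=:\mathcal M_0(G).$$
   Context: $\overline{\sigma}(M)$ denotes the maximum singular value of a matrix $M$. Stable means that all eigenvalues of $A$ have negative real part. The supremum defining $\mathcal K(G)$ is over complex $s$ with $\mathrm{Re}(s)>0$. $\mathcal K(G)$ is called the Kreiss system norm and $\mathcal M_0(G)$ the worst case transient peak norm. *)

theory Defs
  imports "HOL-Analysis.Analysis"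
begin

definition eigenvalue_of :: "'a::field^'n^'n \<Rightarrow> 'a \<Rightarrow> bool" where
  "eigenvalue_of M l \<longleftrightarrow> (\<exists>v. v \<noteq> 0 \<and> M *v v = l *s v)"

definition cmat :: "real^'m^'n \<Rightarrow> complex^'m^'n" where
  "cmat M = map_matrix complex_of_real M"

definition conj_transpose :: "complex^'m^'n \<Rightarrow> complex^'n^'m" where
  "conj_transpose M = map_matrix cnj (transpose M)"

text \<open>
  The singular values are the nonnegative square roots of the eigenvalues of \<open>M\<^sup>* M\<close>.
  For a wide matrix this set contains \<open>0\<close> in addition to the \<open>min p m\<close> singular values of
  the other common convention, which does not affect the maximum.
\<close>

definition singular_values :: "complex^'m^'n \<Rightarrow> real set" where
  "singular_values M =
     {r. 0 \<le> r \<and> eigenvalue_of (conj_transpose M ** M) (complex_of_real (r\<^sup>2))}"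

definition max_singular_value :: "complex^'m^'n \<Rightarrow> real" where
  "max_singular_value M = Max (singular_values M)"

text \<open>
  The type class operations \<open>*\<close> and \<open>^\<close> on vectors and matrices act entrywise, so powers are
  formed by iterating the matrix product \<open>**\<close>.
\<close>

definition mat_power :: "real^'n^'n \<Rightarrow> nat \<Rightarrow> real^'n^'n" where
  "mat_power A k = (((**) A) ^^ k) (mat 1)"

definition mat_exp :: "real^'n^'n \<Rightarrow> real^'n^'n" where
  "mat_exp A = (\<Sum>k. (1 / fact k) *\<^sub>R mat_power A k)"

definition hurwitz_stable :: "real^'n^'n \<Rightarrow> bool" where
  "hurwitz_stable A \<longleftrightarrow> (\<forall>l. eigenvalue_of (cmat A) l \<longrightarrow> Re l < 0)"

definition transfer_function ::
  "real^'n^'n \<Rightarrow> real^'m^'n \<Rightarrow> real^'n^'p \<Rightarrow> complex \<Rightarrow> complex^'m^'p" where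
  "transfer_function A B C s = cmat C ** matrix_inv (mat s - cmat A) ** cmat B"

text \<open>
  Both suprema are taken in the extended reals, so that they are meaningful without a
  boundedness assumption.
\<close>

definition kreiss_norm :: "real^'n^'n \<Rightarrow> real^'m^'n \<Rightarrow> real^'n^'p \<Rightarrow> ereal" where
  "kreiss_norm A B C =
     (SUP s\<in>{s. 0 < Re s}. ereal (Re s * max_singular_value (transfer_function A B C s)))"

definition transient_peak_norm :: "real^'n^'n \<Rightarrow> real^'m^'n \<Rightarrow> real^'n^'p \<Rightarrow> ereal" where
  "transient_peak_norm A B C =
     (SUP t\<in>{0..}. ereal (max_singular_value (cmat (C ** mat_exp (t *\<^sub>R A) ** B))))"

end

theory Submission
  imports Defs "HOL-Computational_Algebra.Fundamental_Theorem_Algebra"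
begin

text \<open>
  For \<open>w = (s - A)\<^sup>-\<^sup>1 B v\<close> the curve \<open>h t = e\<^bsup>-st\<^esup> C e\<^bsup>At\<^esup> w\<close> starts at \<open>G(s) v\<close>
  and has derivative \<open>- e\<^bsup>-st\<^esup> C e\<^bsup>At\<^esup> B v\<close>, of norm at most
  \<open>e\<^bsup>- Re s t\<^esup> M\<^sub>0 |v|\<close>. The mean value inequality on \<open>[0, T]\<close> then gives
  \<open>|h 0 - h T| \<le> M\<^sub>0 |v| / Re s\<close>, with no improper integral needed, and \<open>h T\<close> tends to \<open>0\<close>
  because stability makes \<open>e\<^bsup>At\<^esup> w\<close> bounded.
\<close>

section \<open>The maximum singular value as an operator norm\<close>

text \<open>On complex numbers \<open>inner a b\<close> is the real part of
  \<open>a * cnj b\<close>, so a factor crosses it conjugated. The real inner product therefore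
  still has \<open>conj_transpose\<close> as adjoint, and no Hermitian form has to be
  introduced.\<close>

lemma inner_complex_adjoint: "inner (a * b) c = inner b (cnj a * c)" for a b c :: complex
  by (simp add: inner_complex_def algebra_simps)

lemma inner_conj_transpose:
  "inner (M *v x) y = inner x (conj_transpose M *v y)" for M :: "complex^'m^'n"
proof -
  have "inner (M *v x) y = (\<Sum>i\<in>UNIV. \<Sum>j\<in>UNIV. inner (M$i$j * x$j) (y$i))"
    by (simp add: inner_vec_def matrix_vector_mult_def inner_sum_left)
  also have "\<dots> = (\<Sum>j\<in>UNIV. \<Sum>i\<in>UNIV. inner (x$j) (cnj (M$i$j) * y$i))"
    by (subst sum.swap) (simp add: inner_complex_adjoint)
  also have "\<dots> = inner x (conj_transpose M *v y)"
    by (simp add: inner_vec_def matrix_vector_mult_def inner_sum_right conj_transpose_def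
        transpose_def)
  finally show ?thesis .
qed

lemma inner_gram:
  "inner ((conj_transpose M ** M) *v x) y = inner (M *v x) (M *v y)" for M :: "complex^'m^'n"
  by (metis inner_commute inner_conj_transpose matrix_vector_mul_assoc)

lemma complex_scalar_mult_eq_scaleR: "complex_of_real r *s v = r *\<^sub>R v"
  by (simp add: vec_eq_iff scaleR_conv_of_real[where 'a = complex])

lemma matrix_mult_scaleR: "M *v (r *\<^sub>R v) = r *\<^sub>R (M *v v)" for M :: "complex^'m^'n"
  by (simp add: vector_scalar_commute flip: complex_scalar_mult_eq_scaleR)

lemma singular_values_iff:
  "r \<in> singular_values M \<longleftrightarrow>
     0 \<le> r \<and> (\<exists>v. v \<noteq> 0 \<and> (conj_transpose M ** M) *v v = r\<^sup>2 *\<^sub>R v)"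
  by (simp add: singular_values_def eigenvalue_of_def complex_scalar_mult_eq_scaleR
      del: of_real_power)

text \<open>\<open>Max\<close> is meaningful only on finite sets. The Gram matrix is self-adjoint
  for the real inner product, so eigenvectors chosen for different singular values are orthogonal,
  hence distinct and independent, and the dimension bounds their number.\<close>

lemma finite_singular_values: "finite (singular_values M)" for M :: "complex^'m^'n"
proof -
  let ?H = "conj_transpose M ** M"
  define v where "v r = (SOME v. v \<noteq> 0 \<and> ?H *v v = r\<^sup>2 *\<^sub>R v)" for r
  have v: "v r \<noteq> 0" "?H *v v r = r\<^sup>2 *\<^sub>R v r" if "r \<in> singular_values M" for r
    using someI_ex[of "\<lambda>v. v \<noteq> 0 \<and> ?H *v v = r\<^sup>2 *\<^sub>R v"] that
    unfolding singular_values_iff v_def by blast+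
  have orth: "inner (v r) (v q) = 0"
    if rq: "r \<in> singular_values M" "q \<in> singular_values M" "r \<noteq> q" for r q
  proof -
    have "r\<^sup>2 * inner (v r) (v q) = inner (?H *v v r) (v q)"
      by (simp add: v rq)
    also have "\<dots> = inner (?H *v v q) (v r)"
      unfolding inner_gram by (rule inner_commute)
    also have "\<dots> = q\<^sup>2 * inner (v r) (v q)"
      by (simp add: v rq inner_commute)
    finally have "r\<^sup>2 = q\<^sup>2 \<or> inner (v r) (v q) = 0"
      by (metis mult_cancel_right)
    moreover have "r\<^sup>2 \<noteq> q\<^sup>2"
      using rq by (auto simp: singular_values_iff power2_eq_iff_nonneg)
    ultimately show ?thesis by blast
  qed
  have inj: "inj_on v (singular_values M)"
    by (rule inj_onI) (metis orth v(1) inner_eq_zero_iff)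
  have "pairwise orthogonal (v ` singular_values M)"
    by (auto simp: pairwise_def orthogonal_def intro!: orth)
  then have "independent (v ` singular_values M)"
    by (rule pairwise_orthogonal_independent) (use v in auto)
  then have "finite (v ` singular_values M)"
    using independent_bound by blast
  then show ?thesis
    using inj by (simp add: finite_image_iff)
qed

lemma norm_mult_of_singular_value:
  assumes "r \<in> singular_values M"
  obtains v where "v \<noteq> 0" "norm (M *v v) = r * norm v"
proof -
  obtain v where r: "0 \<le> r" and v: "v \<noteq> 0" "(conj_transpose M ** M) *v v = r\<^sup>2 *\<^sub>R v"
    using assms unfolding singular_values_iff by blast
  have "(norm (M *v v))\<^sup>2 = (r * norm v)\<^sup>2"
    unfolding power2_norm_eq_inner power_mult_distrib by (simp add: v flip: inner_gram)
  then have "norm (M *v v) = r * norm v"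
    using r by (simp add: power2_eq_iff_nonneg)
  with v show ?thesis using that by blast
qed

text \<open>A positive semidefinite form that vanishes at \<open>x\<close> is stationary there. Applied to
  \<open>r\<^sup>2 |y|\<^sup>2 - |M y|\<^sup>2\<close> and a maximiser \<open>x\<close> of the quotient, this says that \<open>x\<close>
  is an eigenvector of the Gram matrix.\<close>

lemma norm_attained_imp_singular_value:
  fixes M :: "complex^'m^'n"
  assumes r: "0 \<le> r" and le: "\<And>y. norm (M *v y) \<le> r * norm y"
    and x: "x \<noteq> 0" "norm (M *v x) = r * norm x"
  shows "r \<in> singular_values M"
proof -
  let ?H = "conj_transpose M ** M"
  \<comment> \<open>\<open>d\<close> is half the gradient at \<open>x\<close> of the form
    \<open>r^2 |y|^2 - |M y|^2\<close>. Along \<open>x + t d\<close> that form equals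
    \<open>2 t a + t^2 b\<close>, and \<open>a = |d|^2\<close> vanishes exactly when
    \<open>x\<close> is the required eigenvector.\<close>
  define d where "d = r\<^sup>2 *\<^sub>R x - ?H *v x"
  define a where "a = inner d d"
  define b where "b = r\<^sup>2 * inner d d - inner (M *v d) (M *v d)"
  have sq: "inner (M *v y) (M *v y) \<le> r\<^sup>2 * inner y y" for y
    using power_mono[OF le[of y], of 2]
    by (simp add: power_mult_distrib power2_norm_eq_inner)
  have eq: "inner (M *v x) (M *v x) = r\<^sup>2 * inner x x"
    using x(2) by (simp add: power_mult_distrib flip: power2_norm_eq_inner)
  have b0: "0 \<le> b"
    using sq[of d] by (simp add: b_def)
  have a: "a = r\<^sup>2 * inner x d - inner (M *v x) (M *v d)"
    unfolding a_def by (subst (1) d_def) (simp add: inner_diff_left inner_gram)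
  have *: "0 \<le> 2 * t * a + t\<^sup>2 * b" for t
  proof -
    have "M *v (x + t *\<^sub>R d) = M *v x + t *\<^sub>R (M *v d)"
      by (simp add: matrix_vector_right_distrib matrix_mult_scaleR)
    then have "0 \<le> r\<^sup>2 * inner (x + t *\<^sub>R d) (x + t *\<^sub>R d)
        - inner (M *v x + t *\<^sub>R (M *v d)) (M *v x + t *\<^sub>R (M *v d))"
      using sq[of "x + t *\<^sub>R d"] by simp
    also have "\<dots> = 2 * t * a + t\<^sup>2 * b"
      using eq unfolding a b_def
      by (simp add: inner_commute inner_add_left inner_add_right algebra_simps power2_eq_square)
    finally show ?thesis .
  qed
  have "a = 0"
  proof (rule ccontr)
    assume "a \<noteq> 0"
    then have a0: "a > 0" by (simp add: a_def)
    \<comment> \<open>The denominator is \<open>b + 1\<close> because \<open>b\<close> may be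
      \<open>0\<close>. A small negative multiple of \<open>d\<close> makes the linear term
      win.\<close>
    define t where "t = - a / (b + 1)"
    have t: "t < 0" "t * (b + 1) = - a"
      using a0 b0 by (auto simp: t_def field_simps)
    have "2 * t * a + t\<^sup>2 * b = t * (2 * a + t * (b + 1) - t)"
      by (simp add: algebra_simps power2_eq_square)
    also have "\<dots> = t * (a - t)"
      using t by simp
    also have "\<dots> < 0"
      using t a0 by (simp add: mult_neg_pos)
    finally show False using *[of t] by simp
  qed
  then have "?H *v x = r\<^sup>2 *\<^sub>R x"
    by (simp add: a_def d_def)
  then show ?thesis
    unfolding singular_values_iff using r x(1) by blast
qed

text \<open>The unit sphere is compact, so the maximum of \<open>|M x|\<close> is attained there;
  that maximum is both a singular value and a bound for \<open>M\<close>. This yields nonemptiness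
  of \<open>singular_values M\<close> and the operator norm bound at once.\<close>

lemma singular_value_norm_bound:
  fixes M :: "complex^'m^'n"
  obtains r where "r \<in> singular_values M" "\<And>y. norm (M *v y) \<le> r * norm y"
proof -
  have "\<exists>x\<in>sphere 0 1. \<forall>y\<in>sphere (0::complex^'m) 1. norm (M *v y) \<le> norm (M *v x)"
    by (rule continuous_attains_sup)
      (auto intro: continuous_on_norm[OF linear_continuous_on[OF matrix_vector_mul_bounded_linear]])
  then obtain x where x: "norm x = 1" and max: "\<And>y. norm y = 1 \<Longrightarrow> norm (M *v y) \<le> norm (M *v x)"
    by auto
  have le: "norm (M *v y) \<le> norm (M *v x) * norm y" for y
  proof (cases "y = 0")
    case False
    then have "norm (M *v ((1 / norm y) *\<^sub>R y)) \<le> norm (M *v x)"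
      by (intro max) simp
    with False show ?thesis
      by (simp add: matrix_mult_scaleR field_simps)
  qed simp
  show ?thesis
    by (rule that[OF norm_attained_imp_singular_value[OF _ le, of x] le]) (use x in auto)
qed

lemma max_singular_value_in: "max_singular_value M \<in> singular_values M"
  unfolding max_singular_value_def
  by (rule Max_in[OF finite_singular_values]) (use singular_value_norm_bound[of M] in blast)

lemma norm_le_max_singular_value: "norm (M *v x) \<le> max_singular_value M * norm x"
proof -
  obtain r where r: "r \<in> singular_values M" "\<And>y. norm (M *v y) \<le> r * norm y"
    using singular_value_norm_bound by blast
  have "r \<le> max_singular_value M"
    unfolding max_singular_value_def by (rule Max_ge[OF finite_singular_values r(1)])
  then show ?thesis
    using r(2)[of x] by (meson mult_right_mono norm_ge_zero order_trans)
qed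

lemma max_singular_value_nonneg: "0 \<le> max_singular_value M"
  using max_singular_value_in[of M] by (simp add: singular_values_iff)

lemma max_singular_value_le:
  assumes "\<And>x. norm (M *v x) \<le> K * norm x"
  shows "max_singular_value M \<le> K"
proof -
  obtain v where v: "v \<noteq> 0" "norm (M *v v) = max_singular_value M * norm v"
    using norm_mult_of_singular_value[OF max_singular_value_in] by blast
  then show ?thesis
    using assms[of v] by simp
qed

section \<open>The matrix exponential\<close>

lemma mat_power_0: "mat_power A 0 = mat 1"
  and mat_power_Suc: "mat_power A (Suc k) = A ** mat_power A k"
  by (simp_all add: mat_power_def)

lemma mat_power_Suc_right: "mat_power A (Suc k) = mat_power A k ** A"
  by (induction k) (simp_all add: mat_power_0 mat_power_Suc matrix_mul_assoc)

lemma mat_power_scaleR: "mat_power (t *\<^sub>R A) k = t ^ k *\<^sub>R mat_power A k"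
proof (induction k)
  case (Suc k)
  have "(t *\<^sub>R A) ** (t ^ k *\<^sub>R mat_power A k) = t ^ Suc k *\<^sub>R (A ** mat_power A k)"
    by (simp add: vec_eq_iff matrix_matrix_mult_def sum_distrib_left mult_ac)
  with Suc show ?case by (simp add: mat_power_Suc)
qed (simp add: mat_power_0)

text \<open>The sum of all absolute entries is a crude submultiplicative majorant, good enough to
  compare each entry series with a scalar exponential series.\<close>

lemma mat_power_entry_bound:
  "\<bar>mat_power A k $ i $ j\<bar> \<le> (\<Sum>i\<in>UNIV. \<Sum>j\<in>UNIV. \<bar>A$i$j\<bar>) ^ k"
proof (induction k arbitrary: i)
  case 0
  show ?case by (simp add: mat_power_0 mat_def)
next
  case (Suc k)
  let ?a = "\<Sum>i\<in>UNIV. \<Sum>j\<in>UNIV. \<bar>A$i$j\<bar>"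
  have "\<bar>mat_power A (Suc k) $ i $ j\<bar> \<le> (\<Sum>l\<in>UNIV. \<bar>A$i$l\<bar> * \<bar>mat_power A k $ l $ j\<bar>)"
    by (auto simp: mat_power_Suc matrix_matrix_mult_def abs_mult[symmetric] intro: sum_abs)
  also have "\<dots> \<le> (\<Sum>l\<in>UNIV. \<bar>A$i$l\<bar>) * ?a ^ k"
    unfolding sum_distrib_right by (intro sum_mono mult_left_mono Suc) auto
  also have "\<dots> \<le> ?a * ?a ^ k"
    by (intro mult_right_mono member_le_sum) (auto intro!: sum_nonneg zero_le_power)
  finally show ?case by simp
qed

lemma summable_mat_exp_entry: "summable (\<lambda>k. mat_power A k $ i $ j / fact k * t ^ k)"
proof (rule summable_comparison_test')
  let ?a = "\<Sum>i\<in>UNIV. \<Sum>j\<in>UNIV. \<bar>A$i$j\<bar>"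
  show "summable (\<lambda>k. inverse (fact k) * (?a * \<bar>t\<bar>) ^ k)"
    by (rule summable_exp)
  show "norm (mat_power A k $ i $ j / fact k * t ^ k) \<le> inverse (fact k) * (?a * \<bar>t\<bar>) ^ k" for k
    using mult_right_mono[OF mat_power_entry_bound[of A k i j], of "\<bar>t\<bar> ^ k / fact k"]
    by (simp add: abs_mult power_abs power_mult_distrib field_simps)
qed

text \<open>Reduces the matrix series to real power series in \<open>t\<close>, one per entry, so
  that termwise differentiation of scalar power series applies.\<close>

lemma mat_exp_entry:
  "mat_exp (t *\<^sub>R A) $ i $ j = (\<Sum>k. mat_power A k $ i $ j / fact k * t ^ k)"
proof -
  have "(\<lambda>k. (1 / fact k) *\<^sub>R mat_power (t *\<^sub>R A) k) sums
      (\<chi> i j. \<Sum>k. mat_power A k $ i $ j / fact k * t ^ k)"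
    unfolding sums_def
  proof (intro vec_tendstoI)
    fix i j
    show "(\<lambda>n. (\<Sum>k<n. (1 / fact k) *\<^sub>R mat_power (t *\<^sub>R A) k) $ i $ j)
      \<longlonglongrightarrow> (\<chi> i j. \<Sum>k. mat_power A k $ i $ j / fact k * t ^ k) $ i $ j"
      using summable_LIMSEQ[OF summable_mat_exp_entry[of A i j t]]
      by (simp add: mat_power_scaleR field_simps)
  qed
  then show ?thesis
    unfolding mat_exp_def by (simp add: sums_unique[symmetric])
qed

lemma mat_exp_0: "mat_exp (0 *\<^sub>R A) = mat 1"
  unfolding vec_eq_iff mat_exp_entry powser_zero by (simp add: mat_power_0)

text \<open>The series on the left is the formal derivative of the entry series: differentiation
  turns \<open>k!\<close> into \<open>(k-1)!\<close> and shifts the index. Splitting off the left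
  factor of \<open>A^(k+1)\<close> sums it.\<close>

lemma mat_exp_mult_entry:
  "(\<Sum>k. mat_power A (Suc k) $ i $ j / fact k * t ^ k) = (A ** mat_exp (t *\<^sub>R A)) $ i $ j"
proof -
  have "(\<Sum>k. mat_power A (Suc k) $ i $ j / fact k * t ^ k)
     = (\<Sum>k. \<Sum>l\<in>UNIV. A$i$l * (mat_power A k $ l $ j / fact k * t ^ k))"
    by (simp add: mat_power_Suc matrix_matrix_mult_def sum_divide_distrib sum_distrib_left
        sum_distrib_right mult_ac)
  also have "\<dots> = (\<Sum>l\<in>UNIV. \<Sum>k. A$i$l * (mat_power A k $ l $ j / fact k * t ^ k))"
    by (intro suminf_sum summable_mult summable_mat_exp_entry)
  also have "\<dots> = (\<Sum>l\<in>UNIV. A$i$l * (\<Sum>k. mat_power A k $ l $ j / fact k * t ^ k))"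
    by (intro sum.cong refl suminf_mult summable_mat_exp_entry)
  finally show ?thesis
    by (simp add: matrix_matrix_mult_def mat_exp_entry)
qed

text \<open>The series of \<open>mat_exp_mult_entry\<close> is summed a second time, now splitting
  off the right factor of \<open>A^(k+1)\<close>.\<close>

lemma mat_exp_commute: "mat_exp (t *\<^sub>R A) ** A = A ** mat_exp (t *\<^sub>R A)"
proof -
  have "(mat_exp (t *\<^sub>R A) ** A) $ i $ j = (A ** mat_exp (t *\<^sub>R A)) $ i $ j" for i j
  proof -
    have "(\<Sum>k. mat_power A (Suc k) $ i $ j / fact k * t ^ k)
       = (\<Sum>k. \<Sum>l\<in>UNIV. A$l$j * (mat_power A k $ i $ l / fact k * t ^ k))"
      by (simp add: mat_power_Suc_right matrix_matrix_mult_def sum_divide_distrib sum_distrib_left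
          sum_distrib_right mult_ac)
    also have "\<dots> = (\<Sum>l\<in>UNIV. \<Sum>k. A$l$j * (mat_power A k $ i $ l / fact k * t ^ k))"
      by (intro suminf_sum summable_mult summable_mat_exp_entry)
    also have "\<dots> = (\<Sum>l\<in>UNIV. A$l$j * (\<Sum>k. mat_power A k $ i $ l / fact k * t ^ k))"
      by (intro sum.cong refl suminf_mult summable_mat_exp_entry)
    also have "\<dots> = (mat_exp (t *\<^sub>R A) ** A) $ i $ j"
      by (simp add: matrix_matrix_mult_def mat_exp_entry mult.commute)
    finally show ?thesis
      by (simp only: mat_exp_mult_entry)
  qed
  then show ?thesis by (simp add: vec_eq_iff)
qed

lemma DERIV_mat_exp_entry:
  "((\<lambda>t. mat_exp (t *\<^sub>R A) $ i $ j) has_field_derivative (A ** mat_exp (t *\<^sub>R A)) $ i $ j) (at t)"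
proof -
  have "diffs (\<lambda>k. mat_power A k $ i $ j / fact k) = (\<lambda>k. mat_power A (Suc k) $ i $ j / fact k)"
    by (auto simp: diffs_def fun_eq_iff field_simps simp del: of_nat_Suc)
  then show ?thesis
    using termdiffs_strong_converges_everywhere[OF summable_mat_exp_entry[of A i j], of t]
    by (simp only: mat_exp_entry mat_exp_mult_entry)
qed

lemma has_vector_derivative_mat_exp:
  "((\<lambda>t. mat_exp (t *\<^sub>R A)) has_vector_derivative A ** mat_exp (t *\<^sub>R A)) (at t)"
  for A :: "real^'n^'n"
  unfolding has_vector_derivative_def
proof (subst has_derivative_componentwise_within, rule ballI)
  fix b :: "real^'n^'n"
  assume "b \<in> Basis"
  then obtain i j where b: "b = axis i (axis j 1)"
    by (auto simp: Basis_vec_def)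
  show "((\<lambda>t. inner (mat_exp (t *\<^sub>R A)) b) has_derivative
      (\<lambda>h. inner (h *\<^sub>R (A ** mat_exp (t *\<^sub>R A))) b)) (at t)"
    using DERIV_mat_exp_entry[of A i j t]
    by (simp add: b inner_axis has_field_derivative_def mult.commute[of _ "(A ** _) $ _ $ _"])
qed

section \<open>The complexified flow\<close>

lemma cmat_mult: "cmat (M ** N) = cmat M ** cmat N"
  by (simp add: cmat_def vec_eq_iff matrix_matrix_mult_def)

lemma cmat_mat_1: "cmat (mat 1) = mat 1"
  by (simp add: cmat_def vec_eq_iff mat_def)

text \<open>Acts on complex vectors, because the resolvent vector \<open>w\<close> is complex even
  though \<open>A\<close> and its exponential are real.\<close>

definition flow :: "real^'n^'n \<Rightarrow> real \<Rightarrow> complex^'n \<Rightarrow> complex^'n" where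
  "flow A t w = cmat (mat_exp (t *\<^sub>R A)) *v w"

lemma flow_0: "flow A 0 w = w"
  using mat_exp_0[of A] by (simp add: flow_def cmat_mat_1)

lemma flow_cmat: "flow A t (cmat A *v w) = cmat A *v flow A t w"
  by (simp add: flow_def matrix_vector_mul_assoc mat_exp_commute flip: cmat_mult)

lemma flow_diff: "flow A t (v - w) = flow A t v - flow A t w"
  by (simp add: flow_def matrix_vector_mult_diff_distrib)

lemma flow_scale: "flow A t (z *s w) = z *s flow A t w"
  by (simp add: flow_def vector_scalar_commute)

lemma linear_cmat_mult: "linear (\<lambda>M. cmat M *v w)"
  by (rule linearI)
    (simp_all add: cmat_def vec_eq_iff matrix_vector_mult_def sum.distrib scaleR_sum_right
      sum_distrib_left algebra_simps scaleR_conv_of_real[where 'a = complex])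

lemma has_vector_derivative_flow:
  "((\<lambda>t. flow A t w) has_vector_derivative cmat A *v flow A t w) (at t)"
proof -
  have "bounded_linear (\<lambda>M. cmat M *v w)"
    using linear_conv_bounded_linear linear_cmat_mult by blast
  from bounded_linear.has_vector_derivative[OF this has_vector_derivative_mat_exp, of A t]
  show ?thesis
    by (simp add: flow_def cmat_mult matrix_vector_mul_assoc matrix_mul_assoc)
qed

lemma norm_scale: "norm (z *s w) = norm z * norm w" for w :: "complex^'n"
  by (simp add: norm_vec_def norm_mult L2_set_right_distrib)

lemma bounded_bilinear_scale:
  "bounded_bilinear (\<lambda>z (w::complex^'n). z *s w)"
  by (rule bounded_bilinear.intro)
    (auto simp: vec_eq_iff algebra_simps norm_scale intro!: exI[of _ 1])

text \<open>Up to \<open>M\<close>, the curve is \<open>e^{(A+z)t} w\<close>, and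
  \<open>A + z\<close> commutes with that exponential. Keeping \<open>A + z\<close> next to
  \<open>w\<close> lets a known value of \<open>(A + z) w\<close> be substituted.\<close>

lemma has_vector_derivative_exp_flow:
  fixes M :: "complex^'n^'p"
  shows "((\<lambda>t. exp (z * of_real t) *s (M *v flow A t w)) has_vector_derivative
     exp (z * of_real t) *s (M *v flow A t (cmat A *v w + z *s w))) (at t)"
proof -
  have "((\<lambda>t. exp (z * of_real t)) has_vector_derivative z * exp (z * of_real t)) (at t)"
    by (rule has_vector_derivative_real_field) (auto intro!: derivative_eq_intros)
  moreover have "((\<lambda>t. M *v flow A t w) has_vector_derivative M *v (cmat A *v flow A t w)) (at t)"
    by (rule bounded_linear.has_vector_derivative[OF _ has_vector_derivative_flow]) simp
  ultimately have "((\<lambda>t. exp (z * of_real t) *s (M *v flow A t w)) has_vector_derivative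
     exp (z * of_real t) *s (M *v (cmat A *v flow A t w))
       + (z * exp (z * of_real t)) *s (M *v flow A t w)) (at t)"
    by (rule bounded_bilinear.has_vector_derivative[OF bounded_bilinear_scale])
  then show ?thesis
    by (simp add: matrix_vector_right_distrib flow_def matrix_vector_mul_assoc
        vector_scalar_commute vector_add_ldistrib mat_exp_commute mult.commute
        flip: cmat_mult)
qed

text \<open>Mean value form of the variation of constants formula
  \<open>e\<^bsup>zT\<^esup> M e\<^bsup>AT\<^esup> w - M w = \<integral> e\<^bsup>zt\<^esup> M e\<^bsup>At\<^esup> (A + z) w dt\<close>.\<close>

lemma exp_flow_bound:
  fixes M :: "complex^'n^'p"
  assumes z: "Re z \<noteq> 0" and T: "0 \<le> T"
    and bnd: "\<And>t. 0 \<le> t \<Longrightarrow> norm (M *v flow A t (cmat A *v w + z *s w)) \<le> K"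
  shows "norm (exp (z * of_real T) *s (M *v flow A T w) - M *v w) \<le> K * (exp (Re z * T) - 1) / Re z"
proof (cases "T = 0")
  case False
  let ?f = "\<lambda>t. exp (z * of_real t) *s (M *v flow A t w)"
  \<comment> \<open>An antiderivative of \<open>K e^{Re z t}\<close>, which dominates the speed of
    \<open>?f\<close>; it is the comparison function of the mean value inequality. That inequality
    needs a nondegenerate interval, hence the separate case \<open>T = 0\<close>.\<close>
  let ?p = "\<lambda>t. K * exp (Re z * t) / Re z"
  have p: "(?p has_vector_derivative K * exp (Re z * t)) (at t)" for t
    using z by (auto intro!: derivative_eq_intros
        simp: has_real_derivative_iff_has_vector_derivative[symmetric])
  have "norm (?f T - ?f 0) \<le> ?p T - ?p 0"
  proof (rule differentiable_bound_general[OF _ _ _ has_vector_derivative_exp_flow p])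
    show "continuous_on {0..T} ?f"
      using has_vector_derivative_exp_flow
      by (blast intro: continuous_at_imp_continuous_on has_vector_derivative_continuous)
    show "continuous_on {0..T} ?p"
      using z by (intro continuous_intros) auto
    show "norm (exp (z * of_real t) *s (M *v flow A t (cmat A *v w + z *s w))) \<le> K * exp (Re z * t)"
      if "0 < t" for t
      using bnd[of t] that by (simp add: norm_scale mult.commute)
  qed (use T False in auto)
  then show ?thesis
    by (simp add: flow_0 diff_divide_distrib right_diff_distrib)
qed (simp add: flow_0)

section \<open>Boundedness of the flow of a stable matrix\<close>

text \<open>Indexed by numbers rather than stated for a set, since the vectors may repeat: a
  repetition is itself a dependence, with coefficients \<open>1\<close> and \<open>-1\<close>, and
  otherwise there are too many distinct vectors.\<close>

lemma linearly_dependent_family: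
  fixes f :: "nat \<Rightarrow> 'a::euclidean_space"
  obtains c where "\<exists>k\<le>DIM('a). c k \<noteq> 0" "(\<Sum>k\<le>DIM('a). c k *\<^sub>R f k) = 0"
proof (cases "inj_on f {..DIM('a)}")
  case True
  let ?S = "f ` {..DIM('a)}"
  have "card ?S > DIM('a)"
    using True by (simp add: card_image)
  then have "dependent ?S"
    by (intro dependent_biggerset) auto
  then obtain u where u: "\<exists>v\<in>?S. u v \<noteq> 0" "(\<Sum>v\<in>?S. u v *\<^sub>R v) = 0"
    by (auto simp: dependent_finite)
  then show ?thesis
    by (intro that[of "u \<circ> f"]) (use True in \<open>auto simp: sum.reindex\<close>)
next
  case False
  then obtain i j where ij: "i \<le> DIM('a)" "j \<le> DIM('a)" "i \<noteq> j" "f i = f j"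
    by (auto simp: inj_on_def)
  let ?c = "\<lambda>k. (if k = i then 1 else 0) - (if k = j then 1 else (0::real))"
  have "(\<Sum>k\<le>DIM('a). ?c k *\<^sub>R f k) = f i - f j"
    using ij by (simp add: scaleR_diff_left sum_subtractf if_distrib[of "\<lambda>r. r *\<^sub>R _"]
        cong: if_cong)
  with ij show ?thesis
    by (intro that[of ?c]) auto
qed

text \<open>The vector \<open>p(A) w\<close>, formed from the iterates of \<open>A\<close> on
  \<open>w\<close> without matrix powers.\<close>

definition poly_act :: "complex^'n^'n \<Rightarrow> complex poly \<Rightarrow> complex^'n \<Rightarrow> complex^'n" where
  "poly_act A p w = (\<Sum>k\<le>degree p. coeff p k *s (((*v) A) ^^ k) w)"

lemma poly_act_degree_le:
  "degree p \<le> N \<Longrightarrow> poly_act A p w = (\<Sum>k\<le>N. coeff p k *s (((*v) A) ^^ k) w)"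
  unfolding poly_act_def by (rule sum.mono_neutral_left) (auto simp: coeff_eq_0)

lemma funpow_matrix_diff_scale:
  "(((*v) A) ^^ k) (v - z *s w) = (((*v) A) ^^ k) v - z *s (((*v) A) ^^ k) w"
  for A :: "complex^'n^'n"
  by (induction k) (simp_all add: matrix_vector_mult_diff_distrib vector_scalar_commute)

lemma poly_act_linear_factor:
  "poly_act A ([:-z, 1:] * q) w = poly_act A q (A *v w - z *s w)"
proof -
  let ?N = "degree q" and ?L = "((*v) A)"
  have "degree ([:-z, 1:] * q) \<le> Suc ?N"
    by (rule order_trans[OF degree_mult_le]) simp
  then have "poly_act A ([:-z, 1:] * q) w
      = (\<Sum>k\<le>Suc ?N. coeff (pCons 0 q) k *s (?L ^^ k) w) - (\<Sum>k\<le>Suc ?N. (z * coeff q k) *s (?L ^^ k) w)"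
    by (simp only: poly_act_degree_le flip: sum_subtractf)
      (auto intro!: sum.cong simp: vec_eq_iff algebra_simps)
  \<comment> \<open>The first sum has no term at index \<open>0\<close>, so shifting it moves one
    application of \<open>A\<close> onto \<open>w\<close>; the top term of the second lies beyond
    the degree of \<open>q\<close>.\<close>
  also have "\<dots> = (\<Sum>k\<le>?N. coeff q k *s (?L ^^ k) (?L w)) - (\<Sum>k\<le>?N. (z * coeff q k) *s (?L ^^ k) w)"
    by (subst sum.atMost_Suc_shift) (simp add: funpow_swap1 coeff_eq_0)
  also have "\<dots> = poly_act A q (A *v w - z *s w)"
    unfolding poly_act_def funpow_matrix_diff_scale sum_subtractf[symmetric]
    by (auto intro!: sum.cong simp: vec_eq_iff algebra_simps)
  finally show ?thesis .
qed

text \<open>Replaces an induction along a triangularisation: a polynomial annihilating \<open>w\<close> splits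
  into linear factors, which are removed one at a time.\<close>

lemma matrix_shift_induct:
  fixes A :: "complex^'n^'n"
  assumes zero: "P 0" and shift: "\<And>z w. P (A *v w - z *s w) \<Longrightarrow> P w"
  shows "P w"
proof -
  let ?d = "DIM(complex^'n)"
  have *: "P w" if "poly_act A p w = 0" "p \<noteq> 0" for p w
    using that
  proof (induction "degree p" arbitrary: p w)
    case 0
    then have "coeff p 0 \<noteq> 0"
      by (metis leading_coeff_0_iff)
    with 0 have "w = 0"
      by (simp add: poly_act_def vec_eq_iff)
    then show ?case using zero by simp
  next
    case (Suc n)
    then have "\<not> constant (poly p)"
      by (simp add: constant_degree)
    then obtain z where "poly p z = 0"
      using fundamental_theorem_of_algebra by blast
    then obtain q where q: "p = [:-z, 1:] * q"
      by (metis poly_eq_0_iff_dvd dvdE)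
    with Suc.prems have "q \<noteq> 0" by auto
    moreover from this have "n = degree q"
      using Suc.hyps(2) by (simp add: q degree_mult_eq del: mult_pCons_left)
    ultimately have "P (A *v w - z *s w)"
      using Suc.hyps(1) Suc.prems(1) by (simp add: q poly_act_linear_factor del: mult_pCons_left)
    then show ?case by (rule shift)
  qed
  \<comment> \<open>The Krylov vectors \<open>w, A w, A^2 w, ...\<close> up to the real dimension of
    the space are one too many to be independent over the reals. A dependence gives the annihilating
    polynomial.\<close>
  obtain c where c: "\<exists>k\<le>?d. c k \<noteq> 0" "(\<Sum>k\<le>?d. c k *\<^sub>R (((*v) A) ^^ k) w) = 0"
    using linearly_dependent_family[of "\<lambda>k. (((*v) A) ^^ k) w"] by blast
  define p where "p = (\<Sum>k\<le>?d. monom (complex_of_real (c k)) k)"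
  have coeff_p: "coeff p k = (if k \<le> ?d then complex_of_real (c k) else 0)" for k
    by (simp add: p_def coeff_sum)
  have "degree p \<le> ?d"
    by (rule degree_le) (simp add: coeff_p)
  then have "poly_act A p w = 0"
    using c(2) by (simp add: poly_act_degree_le coeff_p complex_scalar_mult_eq_scaleR)
  moreover have "p \<noteq> 0"
    using c(1) coeff_p by (metis coeff_0 of_real_eq_0_iff)
  ultimately show ?thesis by (rule *)
qed

lemma mat_mult_vec: "mat z *v w = z *s w" for w :: "'a::field^'n"
  unfolding vec_eq_iff mat_def matrix_vector_mult_def by (simp add: mult_delta_left)

lemma shift_left_inverse:
  fixes A :: "'a::field^'n^'n"
  assumes "\<not> eigenvalue_of A z"
  obtains R where "R ** (A - mat z) = mat 1" "\<And>w. R *v (A *v w - z *s w) = w"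
proof -
  have mat: "(A - mat z) *v w = A *v w - z *s w" for w
    by (simp only: matrix_vector_mult_diff_rdistrib mat_mult_vec)
  have "\<forall>x. (A - mat z) *v x = 0 \<longrightarrow> x = 0"
    using assms unfolding mat eigenvalue_of_def by simp blast
  then obtain R where R: "R ** (A - mat z) = mat 1"
    unfolding matrix_left_invertible_ker[symmetric] ..
  have "R *v (A *v w - z *s w) = w" for w
    unfolding mat[symmetric] by (simp only: matrix_vector_mul_assoc R matrix_vector_mul_lid)
  with R show ?thesis using that by blast
qed

text \<open>Boundedness, rather than decay, passes easily through \<open>matrix_shift_induct\<close>
  and suffices, since the factor \<open>e^{-st}\<close> supplies the decay later.\<close>

lemma flow_bounded:
  fixes A :: "real^'n^'n"
  assumes "hurwitz_stable A"
  shows "\<exists>K. \<forall>t\<ge>0. norm (flow A t w) \<le> K"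
proof (rule matrix_shift_induct[where A = "cmat A"])
  show "\<exists>K. \<forall>t\<ge>0. norm (flow A t 0) \<le> K"
    by (auto simp: flow_def)
next
  fix z and w :: "complex^'n"
  assume "\<exists>K. \<forall>t\<ge>0. norm (flow A t (cmat A *v w - z *s w)) \<le> K"
  then obtain K where K: "\<And>t. t \<ge> 0 \<Longrightarrow> norm (flow A t (cmat A *v w - z *s w)) \<le> K"
    by blast
  show "\<exists>K. \<forall>t\<ge>0. norm (flow A t w) \<le> K"
  \<comment> \<open>The induction offers an arbitrary \<open>z\<close>. If it is not an eigenvalue,
    \<open>A - z\<close> is inverted after moving it through the flow; otherwise stability gives
    \<open>Re z < 0\<close>.\<close>
  proof (cases "eigenvalue_of (cmat A) z")
    case False
    then obtain R where R: "\<And>w. R *v (cmat A *v w - z *s w) = w"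
      using shift_left_inverse by blast
    have "norm (flow A t w) \<le> max_singular_value R * K" if "t \<ge> 0" for t
    proof -
      have "norm (flow A t w) = norm (R *v flow A t (cmat A *v w - z *s w))"
        by (simp add: flow_diff flow_cmat flow_scale R)
      also have "\<dots> \<le> max_singular_value R * norm (flow A t (cmat A *v w - z *s w))"
        by (rule norm_le_max_singular_value)
      also have "\<dots> \<le> max_singular_value R * K"
        by (intro mult_left_mono K that max_singular_value_nonneg)
      finally show ?thesis .
    qed
    then show ?thesis by blast
  next
    case True
    then have z: "Re z < 0"
      using assms by (auto simp: hurwitz_stable_def)
    have K0: "0 \<le> K"
      using K[of 0] norm_ge_zero by (meson order_refl order_trans)
    have "norm (flow A t w) \<le> norm w + K / - Re z" if t: "t \<ge> 0" for t
    proof -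
      let ?e = "exp (- z * of_real t)" and ?E = "exp (- Re z * t)"
      \<comment> \<open>With exponent \<open>-z\<close> the vector \<open>A w + (-z) w\<close> is
        the one whose flow is bounded by \<open>K\<close>. The resulting bound grows like
        \<open>?E\<close>, which also multiplies the flow and is divided out at the end.\<close>
      have "norm (?e *s (mat 1 *v flow A t w) - mat 1 *v w) \<le> K * (exp (Re (- z) * t) - 1) / Re (- z)"
        by (rule exp_flow_bound) (use z t K in \<open>auto simp: vec_eq_iff\<close>)
      then have 1: "norm (?e *s flow A t w - w) \<le> K * (?E - 1) / - Re z"
        by simp
      have "?E * norm (flow A t w) = norm (?e *s flow A t w)"
        by (simp add: norm_scale)
      also have "\<dots> \<le> norm w + norm (?e *s flow A t w - w)"
        by (metis add.commute norm_triangle_sub)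
      also have "\<dots> \<le> norm w + K * (?E - 1) / - Re z"
        using 1 by simp
      also have "\<dots> \<le> ?E * (norm w + K / - Re z)"
      proof -
        have "1 \<le> ?E"
          using z t by (simp add: mult_nonpos_nonneg)
        then have "norm w \<le> ?E * norm w"
          by (simp add: mult_le_cancel_right1)
        moreover have "K * (?E - 1) / - Re z \<le> ?E * (K / - Re z)"
          using z K0 by (simp add: field_simps)
        ultimately show ?thesis unfolding distrib_left by (rule add_mono)
      qed
      finally show ?thesis by simp
    qed
    then show ?thesis by blast
  qed
qed

section \<open>The Kreiss bound\<close>

text \<open>Stability keeps \<open>s\<close> out of the spectrum. As \<open>matrix_inv\<close> is
  defined by choice, its inverse property has to be extracted from invertibility.\<close>

lemma resolvent:
  assumes "hurwitz_stable A" "0 < Re s"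
  shows "matrix_inv (mat s - cmat A) ** (mat s - cmat A) = mat 1"
proof -
  have "\<not> eigenvalue_of (cmat A) s"
    using assms by (force simp: hurwitz_stable_def)
  then obtain R where R: "R ** (cmat A - mat s) = mat 1"
    using shift_left_inverse by blast
  have "(- R) ** (mat s - cmat A) = R ** (cmat A - mat s)"
    by (simp add: vec_eq_iff matrix_matrix_mult_def algebra_simps)
  with R have "invertible (mat s - cmat A)"
    unfolding invertible_left_inverse by metis
  then have "\<exists>R. (mat s - cmat A) ** R = mat 1 \<and> R ** (mat s - cmat A) = mat 1"
    by (simp add: invertible_def)
  from someI_ex[OF this] show ?thesis
    by (simp add: matrix_inv_def)
qed

lemma norm_transfer_function_le:
  fixes A :: "real^'n^'n" and B :: "real^'m^'n" and C :: "real^'n^'p"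
  assumes stable: "hurwitz_stable A" and s: "0 < Re s"
    and K: "\<And>t. 0 \<le> t \<Longrightarrow> max_singular_value (cmat (C ** mat_exp (t *\<^sub>R A) ** B)) \<le> K"
  shows "norm (transfer_function A B C s *v v) \<le> K / Re s * norm v"
proof -
  define R where "R = matrix_inv (mat s - cmat A)"
  define w where "w = R *v (cmat B *v v)"
  have mat: "(mat s - cmat A) *v x = s *s x - cmat A *v x" for x
    by (simp add: matrix_vector_mult_diff_rdistrib mat_mult_vec)
  have "(mat s - cmat A) ** R = mat 1"
    using resolvent[OF stable s] unfolding R_def by (simp add: matrix_left_right_inverse)
  then have "(mat s - cmat A) *v w = cmat B *v v"
    by (simp add: w_def matrix_vector_mul_assoc matrix_mul_assoc)
  \<comment> \<open>This is the driving term for exponent \<open>-s\<close>: the curve's derivative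
    then involves only the impulse response \<open>C e^{At} B v\<close>, up to sign.\<close>
  then have w: "cmat A *v w + (- s) *s w = (- 1) *s (cmat B *v v)"
    unfolding mat by (auto simp: vec_eq_iff algebra_simps)
  have G: "transfer_function A B C s *v v = cmat C *v w"
    by (simp add: transfer_function_def w_def R_def matrix_vector_mul_assoc matrix_mul_assoc)
  have bnd: "norm (cmat C *v flow A t (cmat A *v w + (- s) *s w)) \<le> K * norm v" if "0 \<le> t" for t
  proof -
    have "norm (cmat C *v flow A t (cmat A *v w + (- s) *s w))
        = norm (cmat (C ** mat_exp (t *\<^sub>R A) ** B) *v v)"
      unfolding w flow_scale vector_scalar_commute norm_scale
      by (simp add: flow_def cmat_mult matrix_vector_mul_assoc matrix_mul_assoc)
    also have "\<dots> \<le> max_singular_value (cmat (C ** mat_exp (t *\<^sub>R A) ** B)) * norm v"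
      by (rule norm_le_max_singular_value)
    also have "\<dots> \<le> K * norm v"
      by (intro mult_right_mono K that) simp
    finally show ?thesis .
  qed
  have K0: "0 \<le> K"
    using K[of 0] max_singular_value_nonneg by (meson order_refl order_trans)
  obtain L where L: "\<And>t. 0 \<le> t \<Longrightarrow> norm (flow A t w) \<le> L"
    using flow_bounded[OF stable] by blast
  let ?c = "max_singular_value (cmat C)"
  \<comment> \<open>The left side does not depend on \<open>t\<close>. The last summand bounds the
    endpoint of the curve and vanishes as \<open>t\<close> grows.\<close>
  have le: "norm (cmat C *v w) \<le> K * norm v / Re s + exp (- Re s * t) * (?c * L)" if t: "0 \<le> t" for t
  proof -
    let ?y = "exp (- s * of_real t) *s (cmat C *v flow A t w)"
    have "norm (cmat C *v w) \<le> norm ?y + norm (?y - cmat C *v w)"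
      by (metis norm_minus_commute norm_triangle_sub)
    moreover have "norm (?y - cmat C *v w) \<le> K * norm v * (exp (Re (- s) * t) - 1) / Re (- s)"
      by (rule exp_flow_bound[OF _ t bnd]) (use s in auto)
    moreover have "K * norm v * (exp (Re (- s) * t) - 1) / Re (- s) \<le> K * norm v / Re s"
      using s K0 by (simp add: field_simps)
    moreover have "norm ?y \<le> exp (- Re s * t) * (?c * L)"
    proof -
      have "norm (cmat C *v flow A t w) \<le> ?c * L"
        using norm_le_max_singular_value mult_left_mono[OF L[OF t] max_singular_value_nonneg]
        by (rule order_trans)
      then show ?thesis by (simp add: norm_scale)
    qed
    ultimately show ?thesis by linarith
  qed
  have "((\<lambda>t. exp (- Re s * t)) \<longlongrightarrow> 0) at_top"
    using filterlim_tendsto_neg_mult_at_bot[OF tendsto_const _ filterlim_ident, of "- Re s"] s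
    by (intro filterlim_compose[OF exp_at_bot]) simp
  then have "((\<lambda>t. K * norm v / Re s + exp (- Re s * t) * (?c * L)) \<longlongrightarrow> K * norm v / Re s + 0 * (?c * L)) at_top"
    by (intro tendsto_intros)
  then have "norm (cmat C *v w) \<le> K * norm v / Re s + 0 * (?c * L)"
    by (rule tendsto_lowerbound[OF _ eventually_mono[OF eventually_ge_at_top[of 0] le]]) simp_all
  then show ?thesis by (simp add: G)
qed

theorem theorem1:
  fixes A :: "real^'n^'n" and B :: "real^'m^'n" and C :: "real^'n^'p"
  assumes "hurwitz_stable A"
  shows "kreiss_norm A B C \<le> transient_peak_norm A B C"
  unfolding kreiss_norm_def
proof (rule SUP_least)
  fix s assume "s \<in> {s. 0 < Re s}"
  then have s: "0 < Re s" by simp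
  let ?f = "\<lambda>t. max_singular_value (cmat (C ** mat_exp (t *\<^sub>R A) ** B))"
  have up: "ereal (?f t) \<le> transient_peak_norm A B C" if "0 \<le> t" for t
    unfolding transient_peak_norm_def by (rule SUP_upper) (use that in simp)
  \<comment> \<open>Only a finite peak norm needs the estimate. An infinite one is trivial, and the
    value at \<open>t = 0\<close> excludes minus infinity.\<close>
  show "ereal (Re s * max_singular_value (transfer_function A B C s)) \<le> transient_peak_norm A B C"
  proof (cases "transient_peak_norm A B C")
    case (real K)
    then have "?f t \<le> K" if "0 \<le> t" for t
      using up[OF that] by simp
    then have "norm (transfer_function A B C s *v v) \<le> K / Re s * norm v" for v
      by (rule norm_transfer_function_le[OF assms s])
    then have "max_singular_value (transfer_function A B C s) \<le> K / Re s"
      by (rule max_singular_value_le)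
    then show ?thesis
      using s by (simp add: real field_simps)
  next
    case MInf
    then show ?thesis using up[of 0] by simp
  qed simp
qed

end
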